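(* Let $n\ge 2$ and let $s,y\in\mathbb{R}^n$ satisfy $s^\top y>0$. For $t>0$ put $$\sigma^{\pm}(t)=\sqrt{\frac{t^2\|s\|^4+2t(s^\top y)\|s\|^2+\|s\|^2\|y\|^2}{4(s^\top y)^2}}\ \pm\ \sqrt{\frac{t^2\|s\|^4-2t(s^\top y)\|s\|^2+\|s\|^2\|y\|^2}{4(s^\top y)^2}},$$ and let $\mathrm{HM}(t),\mathrm{GM}(t),\mathrm{AM}(t),\mathrm{QM}(t)$ be the harmonic, geometric, arithmetic and quadratic means of the two positive numbers $\sigma^-(t),\sigma^+(t)$. Then $$t^*:=\frac{\|y\|}{\|s\|}$$ is the minimizer over $t>0$ of each of the six functions $$\frac{\mathrm{AM}(t)}{\mathrm{GM}(t)},\quad \frac{\mathrm{GM}(t)}{\mathrm{HM}(t)},\quad \frac{\mathrm{AM}(t)}{\mathrm{HM}(t)},\quad \frac{\mathrm{QM}(t)}{\mathrm{GM}(t)},\quad \frac{\mathrm{QM}(t)}{\mathrm{HM}(t)},\quad \frac{\mathrm{QM}(t)}{\mathrm{AM}(t)}.$$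
   Context: $\|\cdot\|$ is the Euclidean norm. For positive numbers $a_1,a_2$: $\mathrm{HM}=2/(1/a_1+1/a_2)$, $\mathrm{GM}=\sqrt{a_1a_2}$, $\mathrm{AM}=(a_1+a_2)/2$, $\mathrm{QM}=\sqrt{(a_1^2+a_2^2)/2}$. Here $s=x_{k+1}-x_k$ and $y=\nabla f(x_{k+1})-\nabla f(x_k)$ are the step and gradient displacement of a Dai--Liao conjugate gradient iteration; the Wolfe line search guarantees $s^\top y>0$. The numbers $\sigma^\pm(t)$ are the two generally non-unit singular values (the other $n-2$ being $1$) of the Dai--Liao search direction matrix $I-\frac{sy^\top}{s^\top y}+t\frac{ss^\top}{s^\top y}$. *)

theory Defs
  imports "HOL-Analysis.Analysis"
begin

definition harmonic_mean :: "real \<Rightarrow> real \<Rightarrow> real" where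
  "harmonic_mean a b = 2 / (1 / a + 1 / b)"

definition geometric_mean :: "real \<Rightarrow> real \<Rightarrow> real" where
  "geometric_mean a b = sqrt (a * b)"

definition arithmetic_mean :: "real \<Rightarrow> real \<Rightarrow> real" where
  "arithmetic_mean a b = (a + b) / 2"

definition quadratic_mean :: "real \<Rightarrow> real \<Rightarrow> real" where
  "quadratic_mean a b = sqrt ((a^2 + b^2) / 2)"

(* The two generally non-unit singular values of the Dai-Liao search direction matrix
   I - s y^T / (s^T y) + t s s^T / (s^T y), given by their closed form. *)

definition sigma_plus :: "real^'n \<Rightarrow> real^'n \<Rightarrow> real \<Rightarrow> real" where
  "sigma_plus s y t =
     sqrt ((t^2 * norm s ^ 4 + 2 * t * (s \<bullet> y) * norm s ^ 2 + norm s ^ 2 * norm y ^ 2)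
           / (4 * (s \<bullet> y)^2))
   + sqrt ((t^2 * norm s ^ 4 - 2 * t * (s \<bullet> y) * norm s ^ 2 + norm s ^ 2 * norm y ^ 2)
           / (4 * (s \<bullet> y)^2))"

definition sigma_minus :: "real^'n \<Rightarrow> real^'n \<Rightarrow> real \<Rightarrow> real" where
  "sigma_minus s y t =
     sqrt ((t^2 * norm s ^ 4 + 2 * t * (s \<bullet> y) * norm s ^ 2 + norm s ^ 2 * norm y ^ 2)
           / (4 * (s \<bullet> y)^2))
   - sqrt ((t^2 * norm s ^ 4 - 2 * t * (s \<bullet> y) * norm s ^ 2 + norm s ^ 2 * norm y ^ 2)
           / (4 * (s \<bullet> y)^2))"

definition HM :: "real^'n \<Rightarrow> real^'n \<Rightarrow> real \<Rightarrow> real" where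
  "HM s y t = harmonic_mean (sigma_minus s y t) (sigma_plus s y t)"

definition GM :: "real^'n \<Rightarrow> real^'n \<Rightarrow> real \<Rightarrow> real" where
  "GM s y t = geometric_mean (sigma_minus s y t) (sigma_plus s y t)"

definition AM :: "real^'n \<Rightarrow> real^'n \<Rightarrow> real \<Rightarrow> real" where
  "AM s y t = arithmetic_mean (sigma_minus s y t) (sigma_plus s y t)"

definition QM :: "real^'n \<Rightarrow> real^'n \<Rightarrow> real \<Rightarrow> real" where
  "QM s y t = quadratic_mean (sigma_minus s y t) (sigma_plus s y t)"

(* "x is the minimizer of f over S": x minimizes f on S and is the only point of S doing so. *)
definition is_the_minimizer :: "('a \<Rightarrow> real) \<Rightarrow> 'a set \<Rightarrow> 'a \<Rightarrow> bool" where
  "is_the_minimizer f S x \<longleftrightarrow> {z. is_arg_min f (\<lambda>u. u \<in> S) z} = {x}"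

end

(* Every one of the six ratios is a strictly increasing function of u = AM/GM on [1, \<infinity>):
   GM/HM = u, AM/HM = u^2, QM/GM = sqrt (2 u^2 - 1), QM/HM = u sqrt (2 u^2 - 1) and
   QM/AM = sqrt (2 - 1/u^2).  For the two singular values u(t)^2 = 1/2 + h(t) / (4 s^T y) with
   h(t) = |s|^2 t + |y|^2 / t, and h(t) - 2 |s| |y| = (|s| t - |y|)^2 / t vanishes only at
   t = |y| / |s|. *)
theory Submission
  imports Defs
begin

text \<open>\<open>is_arg_min\<close> only forbids a strictly better point, so it is the strict
  inequality that rules out ties and makes the minimizer unique.\<close>

lemma is_the_minimizerI:
  assumes "x \<in> S" and "\<And>z. z \<in> S \<Longrightarrow> z \<noteq> x \<Longrightarrow> f x < f z"
  shows "is_the_minimizer f S x"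
proof -
  have "is_arg_min f (\<lambda>u. u \<in> S) z \<longleftrightarrow> z = x" for z
    unfolding is_arg_min_def using assms by (metis less_asym)
  then show ?thesis by (simp add: is_the_minimizer_def)
qed

text \<open>Reduces the six claims to one: a strictly increasing outer function \<open>g\<close>
  keeps the strict minimizer of the inner function \<open>u\<close>.\<close>

lemma is_the_minimizer_compose:
  assumes "strict_mono_on T g" and "\<And>t. t \<in> S \<Longrightarrow> u t \<in> T" and "x \<in> S"
    and "\<And>t. t \<in> S \<Longrightarrow> t \<noteq> x \<Longrightarrow> u x < u t"
    and "\<And>t. t \<in> S \<Longrightarrow> f t = g (u t)"
  shows "is_the_minimizer f S x"
  by (rule is_the_minimizerI) (use assms in \<open>auto dest: strict_mono_onD\<close>)

text \<open>The pivot of the proof: its square involves only the sum and the product of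
  \<open>p\<close> and \<open>q\<close>, and for the two singular values both the squared sum and
  the product are free of roots.\<close>

definition am_gm_ratio :: "real \<Rightarrow> real \<Rightarrow> real" where
  "am_gm_ratio p q = arithmetic_mean p q / geometric_mean p q"

context
  fixes p q :: real
  assumes pos: "p > 0" "q > 0"
begin

lemma geometric_mean_pos: "geometric_mean p q > 0"
  using pos by (simp add: geometric_mean_def)

lemma geometric_mean_square: "(geometric_mean p q)\<^sup>2 = p * q"
  using pos by (simp add: geometric_mean_def)

lemma am_gm_ratio_square: "(am_gm_ratio p q)\<^sup>2 = (arithmetic_mean p q)\<^sup>2 / (p * q)"
  by (simp add: am_gm_ratio_def power_divide geometric_mean_square)

text \<open>The AM-GM inequality; it places the ratio in \<open>{1..}\<close>, where the outer
  functions are shown to increase.\<close>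

lemma am_gm_ratio_ge_1: "am_gm_ratio p q \<ge> 1"
  using arith_geo_mean_sqrt[of p q] pos geometric_mean_pos
  by (simp add: am_gm_ratio_def arithmetic_mean_def geometric_mean_def)

lemma gm_hm_ratio: "geometric_mean p q / harmonic_mean p q = am_gm_ratio p q"
proof -
  \<comment> \<open>For two numbers the geometric mean is also the geometric mean of AM and
    HM.\<close>
  have "harmonic_mean p q = (geometric_mean p q)\<^sup>2 / arithmetic_mean p q"
    using pos by (simp add: geometric_mean_square harmonic_mean_def arithmetic_mean_def field_simps)
  then show ?thesis
    using geometric_mean_pos by (simp add: am_gm_ratio_def power2_eq_square)
qed

lemma am_hm_ratio: "arithmetic_mean p q / harmonic_mean p q = (am_gm_ratio p q)\<^sup>2"
proof -
  have "arithmetic_mean p q / harmonic_mean p q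
      = am_gm_ratio p q * (geometric_mean p q / harmonic_mean p q)"
    using geometric_mean_pos by (simp add: am_gm_ratio_def)
  then show ?thesis by (simp add: gm_hm_ratio power2_eq_square)
qed

text \<open>From \<open>p\<^sup>2 + q\<^sup>2 = (p + q)\<^sup>2 - 2 * p * q\<close>, that is, QM
  squared is twice AM squared minus GM squared; divide by GM squared.\<close>

lemma qm_gm_ratio: "quadratic_mean p q / geometric_mean p q = sqrt (2 * (am_gm_ratio p q)\<^sup>2 - 1)"
proof -
  have "(p\<^sup>2 + q\<^sup>2) / 2 / (p * q) = 2 * (am_gm_ratio p q)\<^sup>2 - 1"
    unfolding am_gm_ratio_square using pos
    by (simp add: arithmetic_mean_def field_simps power2_eq_square)
  then show ?thesis
    unfolding quadratic_mean_def geometric_mean_def by (metis real_sqrt_divide)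
qed

lemma qm_hm_ratio:
  "quadratic_mean p q / harmonic_mean p q = sqrt (2 * (am_gm_ratio p q)\<^sup>2 - 1) * am_gm_ratio p q"
proof -
  have "quadratic_mean p q / harmonic_mean p q
      = (quadratic_mean p q / geometric_mean p q) * (geometric_mean p q / harmonic_mean p q)"
    using geometric_mean_pos by simp
  then show ?thesis by (simp only: qm_gm_ratio gm_hm_ratio)
qed

lemma qm_am_ratio: "quadratic_mean p q / arithmetic_mean p q = sqrt (2 - 1 / (am_gm_ratio p q)\<^sup>2)"
proof -
  let ?u = "am_gm_ratio p q"
  have u: "?u \<ge> 1" by (rule am_gm_ratio_ge_1)
  have "quadratic_mean p q / arithmetic_mean p q = (quadratic_mean p q / geometric_mean p q) / ?u"
    unfolding am_gm_ratio_def using geometric_mean_pos by simp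
  also have "\<dots> = sqrt (2 * ?u\<^sup>2 - 1) / ?u"
    by (simp only: qm_gm_ratio)
  also have "\<dots> = sqrt ((2 * ?u\<^sup>2 - 1) / ?u\<^sup>2)"
    using u by (simp add: real_sqrt_divide)
  also have "(2 * ?u\<^sup>2 - 1) / ?u\<^sup>2 = 2 - 1 / ?u\<^sup>2"
    using u by (simp add: field_simps)
  finally show ?thesis .
qed

end

lemma strict_mono_on_square: "strict_mono_on {1..} (\<lambda>u::real. u\<^sup>2)"
  by (intro strict_mono_onI power_strict_mono) auto

lemma strict_mono_on_qm_gm: "strict_mono_on {1..} (\<lambda>u::real. sqrt (2 * u\<^sup>2 - 1))"
  \<comment> \<open>\<open>sqrt\<close> is extended to an odd, strictly increasing function on all
    reals, so comparing the radicands suffices.\<close>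
  using strict_mono_onD[OF strict_mono_on_square] by (intro strict_mono_onI) auto

lemma strict_mono_on_qm_hm: "strict_mono_on {1..} (\<lambda>u::real. sqrt (2 * u\<^sup>2 - 1) * u)"
proof (rule strict_mono_onI)
  fix u v :: real
  assume uv: "u \<in> {1..}" "v \<in> {1..}" "u < v"
  have "u\<^sup>2 \<ge> 1" using uv by (intro one_le_power) simp
  \<comment> \<open>Makes the root at \<open>u\<close> nonnegative, so that the strict inequalities
    of the two factors may be multiplied.\<close>
  then have "2 * u\<^sup>2 - 1 \<ge> 0" by simp
  then show "sqrt (2 * u\<^sup>2 - 1) * u < sqrt (2 * v\<^sup>2 - 1) * v"
    using strict_mono_onD[OF strict_mono_on_qm_gm uv] uv by (intro mult_strict_mono') auto
qed

lemma strict_mono_on_qm_am: "strict_mono_on {1..} (\<lambda>u::real. sqrt (2 - 1 / u\<^sup>2))"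
proof (rule strict_mono_onI)
  fix u v :: real
  assume uv: "u \<in> {1..}" "v \<in> {1..}" "u < v"
  have "u\<^sup>2 < v\<^sup>2" using strict_mono_onD[OF strict_mono_on_square uv] .
  then have "1 / v\<^sup>2 < 1 / u\<^sup>2" using uv by (intro divide_strict_left_mono) auto
  then show "sqrt (2 - 1 / u\<^sup>2) < sqrt (2 - 1 / v\<^sup>2)" by simp
qed

context
  fixes s y :: "real^'n" and t :: real
  assumes sy: "s \<bullet> y > 0" and t: "t > 0"
begin

text \<open>The second root cancels in the sum, and the first radicand is nonnegative because
  \<open>t\<close> and \<open>s \<bullet> y\<close> are positive.\<close>

lemma sigma_sum_square:
  "(arithmetic_mean (sigma_minus s y t) (sigma_plus s y t))\<^sup>2
    = (t\<^sup>2 * norm s ^ 4 + 2 * t * (s \<bullet> y) * norm s ^ 2 + norm s ^ 2 * norm y ^ 2) / (4 * (s \<bullet> y)\<^sup>2)"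
  using sy t by (simp add: arithmetic_mean_def sigma_minus_def sigma_plus_def)

text \<open>By Cauchy-Schwarz the expression is at least what it becomes with
  \<open>norm s * norm y\<close> in place of \<open>s \<bullet> y\<close>, which is a perfect
  square.\<close>

lemma minus_radicand_nonneg:
  "t\<^sup>2 * norm s ^ 4 - 2 * t * (s \<bullet> y) * norm s ^ 2 + norm s ^ 2 * norm y ^ 2 \<ge> 0"
proof -
  have "t\<^sup>2 * norm s ^ 4 - 2 * t * (s \<bullet> y) * norm s ^ 2 + norm s ^ 2 * norm y ^ 2
      = (norm s)\<^sup>2 * ((t * norm s - norm y)\<^sup>2 + 2 * t * (norm s * norm y - s \<bullet> y))"
    by (simp add: algebra_simps power2_eq_square power4_eq_xxxx)
  moreover have "norm s * norm y - s \<bullet> y \<ge> 0"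
    using norm_cauchy_schwarz[of s y] by simp
  ultimately show ?thesis using t by simp
qed

text \<open>A difference of squares: the two radicands differ only in the sign of the term with
  \<open>s \<bullet> y\<close>. Their nonnegativity lets squaring undo the roots.\<close>

lemma sigma_prod: "sigma_minus s y t * sigma_plus s y t = t * (norm s)\<^sup>2 / (s \<bullet> y)"
proof -
  let ?P = "(t\<^sup>2 * norm s ^ 4 + 2 * t * (s \<bullet> y) * norm s ^ 2 + norm s ^ 2 * norm y ^ 2)
    / (4 * (s \<bullet> y)\<^sup>2)"
  let ?M = "(t\<^sup>2 * norm s ^ 4 - 2 * t * (s \<bullet> y) * norm s ^ 2 + norm s ^ 2 * norm y ^ 2)
    / (4 * (s \<bullet> y)\<^sup>2)"
  have "?M \<ge> 0" using minus_radicand_nonneg by simp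
  moreover have "?P \<ge> 0" using sy t by simp
  moreover have "sigma_minus s y t * sigma_plus s y t = (sqrt ?P)\<^sup>2 - (sqrt ?M)\<^sup>2"
    by (simp add: sigma_minus_def sigma_plus_def algebra_simps power2_eq_square)
  ultimately have "sigma_minus s y t * sigma_plus s y t = ?P - ?M" by simp
  also have "\<dots> = 4 * t * (s \<bullet> y) * (norm s)\<^sup>2 / (4 * (s \<bullet> y)\<^sup>2)"
    by (simp flip: diff_divide_distrib)
  also have "\<dots> = t * (norm s)\<^sup>2 / (s \<bullet> y)" using sy by (simp add: power2_eq_square)
  finally show ?thesis .
qed

lemma sigma_pos: "sigma_minus s y t > 0" "sigma_plus s y t > 0"
proof -
  have s: "norm s > 0" using sy by auto
  show plus: "sigma_plus s y t > 0"
    unfolding sigma_plus_def using sy t s minus_radicand_nonneg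
    by (intro add_pos_nonneg real_sqrt_gt_zero divide_pos_pos add_pos_nonneg) auto
  \<comment> \<open>The sign of the difference of roots is read off from the product, since the
    other factor is positive.\<close>
  have "sigma_minus s y t * sigma_plus s y t > 0"
    unfolding sigma_prod using sy t s by simp
  then show "sigma_minus s y t > 0"
    using plus by (simp add: zero_less_mult_iff)
qed

text \<open>Squared sum over product, with the square completed so that \<open>t\<close> occurs only
  in a nonnegative term.\<close>

lemma sigma_am_gm_ratio_square:
  "(am_gm_ratio (sigma_minus s y t) (sigma_plus s y t))\<^sup>2
    = 1 / 2 + (2 * norm s * norm y + (norm s * t - norm y)\<^sup>2 / t) / (4 * (s \<bullet> y))"
proof -
  have "s \<noteq> 0" using sy by auto
  then show ?thesis
    unfolding am_gm_ratio_square[OF sigma_pos] sigma_sum_square sigma_prod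
    using sy t by (simp add: field_simps power2_eq_square power4_eq_xxxx)
qed

end

lemma sigma_am_gm_ratio_less:
  fixes s y :: "real^'n"
  assumes sy: "s \<bullet> y > 0" and t: "t > 0" "t \<noteq> norm y / norm s"
  shows "am_gm_ratio (sigma_minus s y (norm y / norm s)) (sigma_plus s y (norm y / norm s))
    < am_gm_ratio (sigma_minus s y t) (sigma_plus s y t)" (is "?v < ?u")
proof -
  have s: "norm s > 0" and y: "norm y > 0" using sy by auto
  then have t0: "norm y / norm s > 0" by simp
  have "norm s * t - norm y \<noteq> 0" using t s by (auto simp: field_simps)
  then have "(norm s * t - norm y)\<^sup>2 / t / (4 * (s \<bullet> y)) > 0" using t sy by simp
  \<comment> \<open>At \<open>norm y / norm s\<close> the completed square vanishes, so the two
    sides differ by exactly the positive term above.\<close>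
  then have "?v\<^sup>2 < ?u\<^sup>2"
    unfolding sigma_am_gm_ratio_square[OF sy t(1)] sigma_am_gm_ratio_square[OF sy t0]
    using s by (simp add: add_divide_distrib)
  moreover have "?u \<ge> 0"
    using am_gm_ratio_ge_1[OF sigma_pos[OF sy t(1)]] by simp
  ultimately show ?thesis by (rule power2_less_imp_less)
qed

theorem mainTheorem1:
  fixes s y :: "real^'n"
  assumes "CARD('n) \<ge> 2"
    and "s \<bullet> y > 0"
  shows "(\<forall>t>0. sigma_minus s y t > 0 \<and> sigma_plus s y t > 0)
    \<and> is_the_minimizer (\<lambda>t. AM s y t / GM s y t) {0<..} (norm y / norm s)
    \<and> is_the_minimizer (\<lambda>t. GM s y t / HM s y t) {0<..} (norm y / norm s)
    \<and> is_the_minimizer (\<lambda>t. AM s y t / HM s y t) {0<..} (norm y / norm s)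
    \<and> is_the_minimizer (\<lambda>t. QM s y t / GM s y t) {0<..} (norm y / norm s)
    \<and> is_the_minimizer (\<lambda>t. QM s y t / HM s y t) {0<..} (norm y / norm s)
    \<and> is_the_minimizer (\<lambda>t. QM s y t / AM s y t) {0<..} (norm y / norm s)"
proof -
  let ?u = "\<lambda>t. am_gm_ratio (sigma_minus s y t) (sigma_plus s y t)"
  note pos = sigma_pos[OF assms(2)]
  have "s \<noteq> 0" "y \<noteq> 0" using assms(2) by auto
  then have "norm y / norm s \<in> {0<..}" by simp
  \<comment> \<open>What is left for each ratio is a strictly increasing \<open>g\<close> that
    expresses it through \<open>?u\<close>.\<close>
  then have minimizer: "is_the_minimizer f {0<..} (norm y / norm s)"
    if "strict_mono_on {1..} g" and "\<And>t. t > 0 \<Longrightarrow> f t = g (?u t)" for f g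
    using that sigma_am_gm_ratio_less[OF assms(2)] am_gm_ratio_ge_1[OF pos]
    by (intro is_the_minimizer_compose[where g = g and T = "{1..}" and u = ?u]) auto
  have mono_id: "strict_mono_on {1..} (\<lambda>u::real. u)"
    by (simp add: strict_mono_on_def)
  show ?thesis
  proof (intro conjI allI impI)
    show "is_the_minimizer (\<lambda>t. AM s y t / GM s y t) {0<..} (norm y / norm s)"
      by (rule minimizer[OF mono_id]) (simp add: AM_def GM_def am_gm_ratio_def)
    show "is_the_minimizer (\<lambda>t. GM s y t / HM s y t) {0<..} (norm y / norm s)"
      by (rule minimizer[OF mono_id]) (simp add: GM_def HM_def gm_hm_ratio pos)
    show "is_the_minimizer (\<lambda>t. AM s y t / HM s y t) {0<..} (norm y / norm s)"
      by (rule minimizer[OF strict_mono_on_square]) (simp add: AM_def HM_def am_hm_ratio pos)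
    show "is_the_minimizer (\<lambda>t. QM s y t / GM s y t) {0<..} (norm y / norm s)"
      by (rule minimizer[OF strict_mono_on_qm_gm]) (simp add: QM_def GM_def qm_gm_ratio pos)
    show "is_the_minimizer (\<lambda>t. QM s y t / HM s y t) {0<..} (norm y / norm s)"
      by (rule minimizer[OF strict_mono_on_qm_hm]) (simp add: QM_def HM_def qm_hm_ratio pos)
    show "is_the_minimizer (\<lambda>t. QM s y t / AM s y t) {0<..} (norm y / norm s)"
      by (rule minimizer[OF strict_mono_on_qm_am]) (simp add: QM_def AM_def qm_am_ratio pos)
  qed (use pos in auto)
qed

end
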